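(* Let $D$ be a set, let $X$ be a real linear space, let $f\colon D\to X$ be an admissible function and let $S\subseteq D$. Then $S$ is $f$-convex if and only if $\operatorname{cone}(f(S))$ is convex.
   Context: Notation: $\mathbb{R}_+=(0,+\infty)$; $W_n=[0,+\infty)^n\setminus\{(0,\dots,0)\}$. Admissible functions and generalized Bajraktarević means: For a nonzero $x$ in a real linear space $X$, the ray generated by $x$ is $R_x=\{\lambda x\mid\lambda\in\mathbb{R}_+\}$. For $S\subseteq X$, $\operatorname{cone}(S)=\{\lambda x\mid \lambda\in\mathbb{R}_+,\ x\in S\}$. A subset $S$ of $X$ is observable if the rays generated by any two distinct elements of $S$ are disjoint, and conically convex if $\operatorname{cone}(S)$ is convex and $0\notin\operatorname{conv}(S)$. A function $f\colon D\to X$ is admissible if it is injective and $f(D)$ is observable and conically convex. For such $f$, $\pi_f\colon\operatorname{cone}(f(D))\to f(D)$ maps $y$ to the unique point $x\in f(D)$ with $y\in R_x$, and $f^{(-1)}:=f^{-1}\circ\pi_f\colon\operatorname{cone}(f(D))\to D$. For $(x,\lambda)\in D^n\times W_n$ put $\mathscr{B}_f(x,\lambda)=f^{(-1)}\big(\sum_{k=1}^n\lambda_kf(x_k)\big)$. A subset $S\subseteq D$ is $f$-convex if $\mathscr{B}_f(x,\lambda)\in S$ for all $n\in\mathbb{N}$ and $(x,\lambda)\in S^n\times W_n$. *)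

theory Defs
  imports "HOL-Analysis.Analysis"
begin

definition ray :: "'b::real_vector \<Rightarrow> 'b set" where
  "ray x = {l *\<^sub>R x | l. l > 0}"

(* Only strictly positive multiples are taken, so this is neither the predicate cone of
   HOL-Analysis nor its conic hull, both of which allow the factor 0. *)
definition pos_cone :: "'b::real_vector set \<Rightarrow> 'b set" where
  "pos_cone S = {l *\<^sub>R x | l x. l > 0 \<and> x \<in> S}"

(* Rays are meant for nonzero vectors only. This is not required here; for the sets f ` D of
   admissible functions it follows from 0 not being in the convex hull. *)
definition observable :: "'b::real_vector set \<Rightarrow> bool" where
  "observable S \<longleftrightarrow> (\<forall>x\<in>S. \<forall>y\<in>S. x \<noteq> y \<longrightarrow> ray x \<inter> ray y = {})"

definition conically_convex :: "'b::real_vector set \<Rightarrow> bool" where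
  "conically_convex S \<longleftrightarrow> convex (pos_cone S) \<and> 0 \<notin> convex hull S"

definition admissible :: "'a set \<Rightarrow> ('a \<Rightarrow> 'b::real_vector) \<Rightarrow> bool" where
  "admissible D f \<longleftrightarrow> inj_on f D \<and> observable (f ` D) \<and> conically_convex (f ` D)"

(* Meaningful only for y in pos_cone (f ` D), where the point is unique if f is admissible. *)
definition ray_proj :: "'a set \<Rightarrow> ('a \<Rightarrow> 'b::real_vector) \<Rightarrow> 'b \<Rightarrow> 'b" where
  "ray_proj D f y = (THE x. x \<in> f ` D \<and> y \<in> ray x)"

definition gen_inv :: "'a set \<Rightarrow> ('a \<Rightarrow> 'b::real_vector) \<Rightarrow> 'b \<Rightarrow> 'a" where
  "gen_inv D f = inv_into D f \<circ> ray_proj D f"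

(* n-tuples over A are the extensional functions in {1..n} \<rightarrow>\<^sub>E A. *)
definition weights :: "nat \<Rightarrow> (nat \<Rightarrow> real) set" where
  "weights n = ({1..n} \<rightarrow>\<^sub>E {0..}) - {\<lambda>k\<in>{1..n}. 0}"

definition bajraktarevic_mean ::
    "'a set \<Rightarrow> ('a \<Rightarrow> 'b::real_vector) \<Rightarrow> nat \<Rightarrow> (nat \<Rightarrow> 'a) \<Rightarrow> (nat \<Rightarrow> real) \<Rightarrow> 'a" where
  "bajraktarevic_mean D f n x l = gen_inv D f (\<Sum>k=1..n. l k *\<^sub>R f (x k))"

definition f_convex :: "'a set \<Rightarrow> ('a \<Rightarrow> 'b::real_vector) \<Rightarrow> 'a set \<Rightarrow> bool" where
  "f_convex D f S \<longleftrightarrow>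
    (\<forall>n\<ge>1. \<forall>x \<in> {1..n} \<rightarrow>\<^sub>E S. \<forall>l \<in> weights n. bajraktarevic_mean D f n x l \<in> S)"

end

theory Submission
  imports Defs
begin

text \<open>
  The generalized inverse of an admissible \<open>f\<close> sends a vector \<open>y\<close> of the cone over \<open>f ` D\<close> to the
  only \<open>d \<in> D\<close> whose image lies on the ray of \<open>y\<close>. Hence for \<open>S \<subseteq> D\<close> the value at \<open>y\<close> lies in \<open>S\<close>
  exactly when \<open>y\<close> lies in the smaller cone over \<open>f ` S\<close> (\<open>gen_inv_mem_iff\<close>), and \<open>f\<close>-convexity of
  \<open>S\<close> says no more than that every nontrivial nonnegative combination of vectors of \<open>f ` S\<close> lies in
  the cone over \<open>f ` S\<close> (\<open>mean_mem_iff\<close>).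

  Closure under such combinations is the same as convexity of the cone. A convex set that is
  invariant under positive scaling is closed under addition, hence under all these combinations
  (\<open>sum_mem_pos_cone\<close>). Conversely, a convex combination of two vectors of the cone is a nonnegative
  combination of two vectors of \<open>f ` S\<close>, so means of two points suffice for this direction.
\<close>

lemma pos_cone_scaleR:
  assumes "a \<in> pos_cone T" "c > 0"
  shows "c *\<^sub>R a \<in> pos_cone T"
proof -
  obtain l x where "l > 0" "x \<in> T" "a = l *\<^sub>R x"
    using assms(1) unfolding pos_cone_def by blast
  then have "c *\<^sub>R a = (c * l) *\<^sub>R x" "c * l > 0"
    using assms(2) by auto
  then show ?thesis
    using \<open>x \<in> T\<close> unfolding pos_cone_def by blast
qed

lemma pos_cone_add:
  assumes "convex (pos_cone T)" "a \<in> pos_cone T" "b \<in> pos_cone T"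
  shows "a + b \<in> pos_cone T"
proof -
  have "(1/2) *\<^sub>R a + (1/2) *\<^sub>R b \<in> pos_cone T"
    using assms by (intro convexD) auto
  then have "2 *\<^sub>R ((1/2) *\<^sub>R a + (1/2) *\<^sub>R b) \<in> pos_cone T"
    by (rule pos_cone_scaleR) simp
  then show ?thesis
    by (simp add: scaleR_add_right)
qed

text \<open>
  Since the cone may omit \<open>0\<close>, the terms of weight zero cannot be treated as members of it; the
  induction needs the positive weight to tell a partial sum in the cone from one that vanishes.
\<close>

lemma sum_mem_pos_cone:
  assumes "convex (pos_cone T)" "finite I"
    and "\<And>i. i \<in> I \<Longrightarrow> u i \<in> T" "\<And>i. i \<in> I \<Longrightarrow> l i \<ge> 0" "\<exists>i\<in>I. l i > 0"
  shows "(\<Sum>i\<in>I. l i *\<^sub>R u i) \<in> pos_cone T"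
  using assms(2-)
proof (induction I rule: finite_induct)
  case empty
  then show ?case by simp
next
  case (insert j I)
  have term_j: "l j *\<^sub>R u j \<in> pos_cone T" if "l j > 0"
    using that insert.prems(1) unfolding pos_cone_def by blast
  show ?case
  proof (cases "\<exists>i\<in>I. l i > 0")
    case True
    then have rest: "(\<Sum>i\<in>I. l i *\<^sub>R u i) \<in> pos_cone T"
      using insert by auto
    show ?thesis
    proof (cases "l j > 0")
      case True
      then show ?thesis
        using insert.hyps pos_cone_add[OF assms(1) term_j rest] by simp
    next
      case False
      then have "l j = 0"
        using insert.prems(2)[of j] by simp
      then show ?thesis
        using insert.hyps rest by simp
    qed
  next
    case False
    then have zero: "l i = 0" if "i \<in> I" for i
      using insert.prems(2)[of i] that by force
    have "l j > 0"
      using False insert.prems(3) by auto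
    then show ?thesis
      using insert.hyps zero term_j by simp
  qed
qed

lemma weights_nonneg: "l \<in> weights n \<Longrightarrow> k \<in> {1..n} \<Longrightarrow> l k \<ge> 0"
  unfolding weights_def by auto

text \<open>
  The excluded tuple is the zero function restricted to the index range, so extensionality is what
  turns being different from it into having a positive entry.
\<close>

lemma weights_exists_pos:
  assumes "l \<in> weights n"
  shows "\<exists>k\<in>{1..n}. l k > 0"
proof (rule ccontr)
  assume "\<not> ?thesis"
  then have "l k = 0" if "k \<in> {1..n}" for k
    using weights_nonneg[OF assms that] that by force
  moreover have "l \<in> extensional {1..n}"
    using assms unfolding weights_def by (auto simp: PiE_def)
  ultimately have "l = (\<lambda>k\<in>{1..n}. 0)"
    by (intro extensionalityI[of _ "{1..n}"]) auto
  then show False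
    using assms unfolding weights_def by simp
qed

text \<open>
  Observability makes the point of \<open>f ` D\<close> on the ray unique, and injectivity makes its preimage
  unique.
\<close>

lemma gen_inv_eq:
  assumes "admissible D f" "d \<in> D" "y \<in> ray (f d)"
  shows "gen_inv D f y = d"
proof -
  have "ray_proj D f y = f d"
    unfolding ray_proj_def
  proof (rule the_equality)
    show "x = f d" if "x \<in> f ` D \<and> y \<in> ray x" for x
      using that assms unfolding admissible_def observable_def by blast
  qed (use assms in auto)
  then show ?thesis
    using assms unfolding gen_inv_def admissible_def by simp
qed

lemma pos_cone_image_iff: "y \<in> pos_cone (f ` S) \<longleftrightarrow> (\<exists>d\<in>S. y \<in> ray (f d))"
  unfolding pos_cone_def ray_def by auto

lemma gen_inv_mem_iff:
  assumes "admissible D f" "S \<subseteq> D" "y \<in> pos_cone (f ` D)"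
  shows "gen_inv D f y \<in> S \<longleftrightarrow> y \<in> pos_cone (f ` S)"
proof -
  obtain d where d: "d \<in> D" "y \<in> ray (f d)"
    using assms(3) unfolding pos_cone_image_iff by blast
  have eq: "gen_inv D f y = e" if "e \<in> D" "y \<in> ray (f e)" for e
    using gen_inv_eq[OF assms(1) that] .
  show ?thesis
    unfolding pos_cone_image_iff
  proof
    show "\<exists>e\<in>S. y \<in> ray (f e)" if "gen_inv D f y \<in> S"
      using that d(2) unfolding eq[OF d] by (rule bexI[rotated])
    show "gen_inv D f y \<in> S" if "\<exists>e\<in>S. y \<in> ray (f e)"
      using that eq assms(2) by auto
  qed
qed

text \<open>
  Admissibility includes convexity of the cone over \<open>f ` D\<close>, which keeps the weighted sum inside the
  domain of the generalized inverse.
\<close>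

lemma mean_mem_iff:
  assumes "admissible D f" "S \<subseteq> D" "x \<in> {1..n} \<rightarrow>\<^sub>E S" "l \<in> weights n"
  shows "bajraktarevic_mean D f n x l \<in> S \<longleftrightarrow> (\<Sum>k=1..n. l k *\<^sub>R f (x k)) \<in> pos_cone (f ` S)"
proof -
  have "(\<Sum>k=1..n. l k *\<^sub>R f (x k)) \<in> pos_cone (f ` D)"
  proof (rule sum_mem_pos_cone)
    show "convex (pos_cone (f ` D))"
      using assms(1) unfolding admissible_def conically_convex_def by simp
    show "f (x k) \<in> f ` D" if "k \<in> {1..n}" for k
      using assms(2) PiE_mem[OF assms(3) that] by blast
  qed (use weights_nonneg[OF assms(4)] weights_exists_pos[OF assms(4)] in auto)
  then show ?thesis
    unfolding bajraktarevic_mean_def using gen_inv_mem_iff assms(1,2) by blast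
qed

theorem proposition5p1:
  fixes D S :: "'a set" and f :: "'a \<Rightarrow> 'b::real_vector"
  assumes "admissible D f" and "S \<subseteq> D"
  shows "f_convex D f S \<longleftrightarrow> convex (pos_cone (f ` S))"
proof
  assume convex: "convex (pos_cone (f ` S))"
  show "f_convex D f S"
    unfolding f_convex_def
  proof (intro allI impI ballI)
    fix n x l
    assume x: "x \<in> {1..n} \<rightarrow>\<^sub>E S" and l: "l \<in> weights n"
    have "(\<Sum>k=1..n. l k *\<^sub>R f (x k)) \<in> pos_cone (f ` S)"
    proof (rule sum_mem_pos_cone[OF convex])
      show "f (x k) \<in> f ` S" if "k \<in> {1..n}" for k
        using PiE_mem[OF x that] by blast
    qed (use weights_nonneg[OF l] weights_exists_pos[OF l] in auto)
    then show "bajraktarevic_mean D f n x l \<in> S"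
      using mean_mem_iff[OF assms x l] by blast
  qed
next
  assume means: "f_convex D f S"
  show "convex (pos_cone (f ` S))"
  proof (rule convexI)
    fix a b :: 'b and u v :: real
    assume ab: "a \<in> pos_cone (f ` S)" "b \<in> pos_cone (f ` S)"
      and uv: "0 \<le> u" "0 \<le> v" "u + v = 1"
    obtain p c where p: "p \<in> S" "c > 0" "a = c *\<^sub>R f p"
      using ab(1) unfolding pos_cone_def by blast
    obtain q d where q: "q \<in> S" "d > 0" "b = d *\<^sub>R f q"
      using ab(2) unfolding pos_cone_def by blast
    define x where "x = (\<lambda>k\<in>{1..2::nat}. if k = 1 then p else q)"
    define l where "l = (\<lambda>k\<in>{1..2::nat}. if k = 1 then u * c else v * d)"
    have x: "x \<in> {1..2} \<rightarrow>\<^sub>E S"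
      unfolding x_def using p q by auto
    have "l 1 \<noteq> 0 \<or> l 2 \<noteq> 0"
      unfolding l_def using p q uv by auto
    then have "l \<noteq> (\<lambda>k\<in>{1..2}. 0)"
      by auto
    moreover have "l \<in> {1..2} \<rightarrow>\<^sub>E {0..}"
      unfolding l_def using p q uv by auto
    ultimately have l: "l \<in> weights 2"
      unfolding weights_def by blast
    have "bajraktarevic_mean D f 2 x l \<in> S"
      using means[unfolded f_convex_def, rule_format, OF _ x l] by simp
    then have "(\<Sum>k=1..2. l k *\<^sub>R f (x k)) \<in> pos_cone (f ` S)"
      using mean_mem_iff[OF assms x l] by blast
    moreover have "{1..2::nat} = {1, 2}"
      by auto
    ultimately show "u *\<^sub>R a + v *\<^sub>R b \<in> pos_cone (f ` S)"
      unfolding x_def l_def using p q by simp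
  qed
qed

end
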